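(* The conclusion of the following implication fails for $c_0$: "if an infinite dimensional normed space $E$ has an infinite dimensional subspace $F$ such that $c_0$ is not isomorphic to a subspace of the completion of $F$, then $\Gamma_2(E)$ is non-shrinking". That is, $\Gamma_2(c_0)$ is not non-shrinking.
   Context: $c_0$ is the Banach space of real sequences converging to $0$ with the supremum norm. A semigroup $\Gamma$ (under composition) of functions from a metric space $X$ to itself is non-shrinking if there are no $g\in\Gamma$, $x\in X$ and $r>0$ such that $g(B(x,r))$ is contained in a finite union of closed balls with radius $<r$, where $B(x,r)$ is the closed ball. For a normed space $E$ with completion $\overline E$, $\widehat\Gamma_2(E)$ is the set of all functions $h:E\to E$ (not necessarily continuous) for which there is a set of pairs $\{(\widehat S_j,E_j) : j\in J\}$, each $E_j$ a finite dimensional linear subspace of $E$, such that: (1) every $\widehat S_j$ is a weakly closed subset of $\overline E$; (2) $\{\widehat S_j : j\in J\}$ is locally finite in $\overline E$; (3) $\bigcup_j\widehat S_j$ is bounded; (4) $h(x)-x\in E_j$ for every $j\in J$ and $x\in\widehat S_j\cap E$, and $h(x)=x$ for every $x\in E\setminus\bigcup_j\widehat S_j$. $\Gamma_2(E)$ is the semigroup generated by $\widehat\Gamma_2(E)$ under composition. *)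

theory Defs
  imports "HOL-Analysis.Analysis"
begin

section \<open>The Banach space of real null sequences\<close>

typedef c0 = "{x :: nat \<Rightarrow> real. x \<longlonglongrightarrow> 0}"
  morphisms seq_c0 Abs_c0
  by (intro exI[of _ "\<lambda>_. 0"]) auto

setup_lifting type_definition_c0

lemma c0_eqI: "(\<And>n. seq_c0 x n = seq_c0 y n) \<Longrightarrow> x = y"
  by (simp add: seq_c0_inject[symmetric] fun_eq_iff)

lemma seq_c0_tendsto: "seq_c0 x \<longlonglongrightarrow> 0"
  using seq_c0[of x] by simp

lemma seq_c0_bdd: "bdd_above (range (\<lambda>n. \<bar>seq_c0 x n\<bar>))"
proof -
  have "Bseq (seq_c0 x)"
    using seq_c0_tendsto[of x] by (intro convergent_imp_Bseq) (auto simp: convergent_def)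
  then obtain K where "\<And>n. norm (seq_c0 x n) \<le> K" by (auto simp: Bseq_def)
  then show ?thesis by (auto intro!: bdd_aboveI[of _ K])
qed

instantiation c0 :: real_vector
begin
lift_definition zero_c0 :: c0 is "\<lambda>_. 0" by simp
lift_definition plus_c0 :: "c0 \<Rightarrow> c0 \<Rightarrow> c0" is "\<lambda>x y n. x n + y n"
  using tendsto_add_zero by blast
lift_definition minus_c0 :: "c0 \<Rightarrow> c0 \<Rightarrow> c0" is "\<lambda>x y n. x n - y n"
  using tendsto_diff by fastforce
lift_definition uminus_c0 :: "c0 \<Rightarrow> c0" is "\<lambda>x n. - x n"
  using tendsto_minus by fastforce
lift_definition scaleR_c0 :: "real \<Rightarrow> c0 \<Rightarrow> c0" is "\<lambda>a x n. a * x n"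
  using tendsto_mult_right_zero by blast
instance
  by standard (transfer; simp add: fun_eq_iff algebra_simps)+
end

instantiation c0 :: real_normed_vector
begin
definition norm_c0 :: "c0 \<Rightarrow> real" where "norm_c0 x = (SUP n. \<bar>seq_c0 x n\<bar>)"
definition dist_c0 :: "c0 \<Rightarrow> c0 \<Rightarrow> real" where "dist_c0 x y = norm (x - y)"
definition sgn_c0 :: "c0 \<Rightarrow> c0" where "sgn_c0 x = x /\<^sub>R norm x"
definition uniformity_c0 :: "(c0 \<times> c0) filter" where
  "uniformity_c0 = (INF e\<in>{0<..}. principal {(x, y). dist x y < e})"
definition open_c0 :: "c0 set \<Rightarrow> bool" where
  "open_c0 U = (\<forall>x\<in>U. eventually (\<lambda>(x', y). x' = x \<longrightarrow> y \<in> U) uniformity)"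

lemma abs_seq_c0_le_norm: "\<bar>seq_c0 x n\<bar> \<le> norm x"
  unfolding norm_c0_def by (rule cSUP_upper[OF _ seq_c0_bdd]) simp

lemma norm_c0_le: "(\<And>n. \<bar>seq_c0 x n\<bar> \<le> a) \<Longrightarrow> norm x \<le> a"
  unfolding norm_c0_def by (rule cSUP_least) auto

instance
proof
  fix x y :: c0 and a :: real
  have nonneg: "0 \<le> norm z" for z :: c0
    using abs_seq_c0_le_norm[of z 0] by linarith
  show "(norm x = 0) = (x = 0)"
  proof
    assume "norm x = 0"
    then have "seq_c0 x n = 0" for n using abs_seq_c0_le_norm[of x n] by simp
    then show "x = 0" by (intro c0_eqI) (simp add: zero_c0.rep_eq)
  qed (simp add: norm_c0_def zero_c0.rep_eq)
  show "norm (x + y) \<le> norm x + norm y"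
  proof (rule norm_c0_le)
    fix n
    show "\<bar>seq_c0 (x + y) n\<bar> \<le> norm x + norm y"
      using abs_seq_c0_le_norm[of x n] abs_seq_c0_le_norm[of y n]
      by (simp add: plus_c0.rep_eq)
  qed
  have le: "norm (b *\<^sub>R z) \<le> \<bar>b\<bar> * norm z" for b and z :: c0
    by (rule norm_c0_le)
      (simp add: scaleR_c0.rep_eq abs_mult abs_seq_c0_le_norm mult_left_mono)
  show "norm (a *\<^sub>R x) = \<bar>a\<bar> * norm x"
  proof (cases "a = 0")
    case True
    then show ?thesis using le[of a x] nonneg[of "a *\<^sub>R x"] by simp
  next
    case False
    have "norm x \<le> \<bar>inverse a\<bar> * norm (a *\<^sub>R x)"
      using le[of "inverse a" "a *\<^sub>R x"] False by simp
    then have "\<bar>a\<bar> * norm x \<le> norm (a *\<^sub>R x)"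
      using False by (simp add: field_simps)
    with le[of a x] show ?thesis by simp
  qed
qed (rule dist_c0_def sgn_c0_def uniformity_c0_def open_c0_def)+
end

instance c0 :: banach
proof
  fix X :: "nat \<Rightarrow> c0"
  assume X: "Cauchy X"
  have diff: "\<bar>seq_c0 x n - seq_c0 y n\<bar> \<le> dist x y" for x y n
    using abs_seq_c0_le_norm[of "x - y" n] by (simp add: minus_c0.rep_eq dist_norm)
  have "Cauchy (\<lambda>k. seq_c0 (X k) n)" for n
    using X diff unfolding Cauchy_def dist_real_def by (meson le_less_trans)
  then have "\<exists>l. (\<lambda>k. seq_c0 (X k) n) \<longlonglongrightarrow> l" for n
    using Cauchy_convergent convergent_def by blast
  then obtain l where l: "\<And>n. (\<lambda>k. seq_c0 (X k) n) \<longlonglongrightarrow> l n" by metis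
  have unif: "\<exists>M. \<forall>k\<ge>M. \<forall>n. \<bar>seq_c0 (X k) n - l n\<bar> \<le> e" if "e > 0" for e
  proof -
    from metric_CauchyD[OF X that]
    obtain M where M: "\<And>k m. k \<ge> M \<Longrightarrow> m \<ge> M \<Longrightarrow> dist (X k) (X m) < e" by blast
    have "\<bar>seq_c0 (X k) n - l n\<bar> \<le> e" if "k \<ge> M" for k n
    proof (rule Lim_bounded)
      show "(\<lambda>m. \<bar>seq_c0 (X k) n - seq_c0 (X m) n\<bar>) \<longlonglongrightarrow> \<bar>seq_c0 (X k) n - l n\<bar>"
        by (intro tendsto_intros l)
      show "\<forall>m\<ge>M. \<bar>seq_c0 (X k) n - seq_c0 (X m) n\<bar> \<le> e"
        using M[OF that] diff by (meson le_less_trans less_imp_le)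
    qed
    then show ?thesis by blast
  qed
  have l0: "l \<longlonglongrightarrow> 0"
  proof (rule LIMSEQ_I)
    fix r :: real
    assume "r > 0"
    then obtain M where "\<forall>k\<ge>M. \<forall>n. \<bar>seq_c0 (X k) n - l n\<bar> \<le> r / 2"
      using unif[of "r / 2"] by auto
    then have M: "\<And>n. \<bar>seq_c0 (X M) n - l n\<bar> \<le> r / 2" by blast
    obtain N where N: "\<And>n. n \<ge> N \<Longrightarrow> norm (seq_c0 (X M) n - 0) < r / 2"
      using LIMSEQ_D[OF seq_c0_tendsto, of "r / 2" "X M"] \<open>r > 0\<close> by auto
    have "norm (l n - 0) < r" if "n \<ge> N" for n
      using M[of n] N[OF that] unfolding real_norm_def by linarith
    then show "\<exists>no. \<forall>n\<ge>no. norm (l n - 0) < r" by blast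
  qed
  have rep: "seq_c0 (Abs_c0 l) = l"
    using l0 by (simp add: Abs_c0_inverse)
  have "X \<longlonglongrightarrow> Abs_c0 l"
  proof (rule LIMSEQ_I)
    fix r :: real
    assume "r > 0"
    then obtain M where M: "\<forall>k\<ge>M. \<forall>n. \<bar>seq_c0 (X k) n - l n\<bar> \<le> r / 2"
      using unif[of "r / 2"] by auto
    have "norm (X k - Abs_c0 l) < r" if "k \<ge> M" for k
    proof -
      have "norm (X k - Abs_c0 l) \<le> r / 2"
        by (rule norm_c0_le) (use M that rep in \<open>simp add: minus_c0.rep_eq\<close>)
      with \<open>r > 0\<close> show ?thesis by simp
    qed
    then show "\<exists>no. \<forall>k\<ge>no. norm (X k - Abs_c0 l) < r" by blast
  qed
  then show "convergent X" by (auto simp: convergent_def)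
qed


section \<open>Non-shrinking semigroups of functions\<close>

inductive_set generated_semigroup :: "('a \<Rightarrow> 'a) set \<Rightarrow> ('a \<Rightarrow> 'a) set"
  for H :: "('a \<Rightarrow> 'a) set" where
  base: "h \<in> H \<Longrightarrow> h \<in> generated_semigroup H"
| comp: "g \<in> generated_semigroup H \<Longrightarrow> h \<in> generated_semigroup H \<Longrightarrow>
    g \<circ> h \<in> generated_semigroup H"

text \<open>A pair \<open>(c, s)\<close> in \<open>C\<close> stands for the closed ball with centre \<open>c\<close> and radius \<open>s\<close>.\<close>

definition non_shrinking :: "('a::metric_space \<Rightarrow> 'a) set \<Rightarrow> bool" where
  "non_shrinking \<Gamma> \<longleftrightarrow>
    \<not> (\<exists>g\<in>\<Gamma>. \<exists>x r. r > 0 \<and>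
        (\<exists>C. finite C \<and> (\<forall>(c, s)\<in>C. s < r) \<and> g ` cball x r \<subseteq> (\<Union>(c, s)\<in>C. cball c s)))"


section \<open>The semigroup associated with a normed space\<close>

text \<open>
  A completion of a normed space is given by a linear isometry \<open>\<iota>\<close> onto a dense subspace
  of a Banach space; it is unique up to isometric isomorphism.
\<close>

definition is_completion :: "('a::real_normed_vector \<Rightarrow> 'b::banach) \<Rightarrow> bool" where
  "is_completion \<iota> \<longleftrightarrow> linear \<iota> \<and> (\<forall>x. norm (\<iota> x) = norm x) \<and> closure (range \<iota>) = UNIV"

lemma is_completion_id: "is_completion (id :: 'a::banach \<Rightarrow> 'a)"
  by (simp add: is_completion_def linear_id)

definition weak_topology :: "'b::real_normed_vector topology" where
  "weak_topology =
    topology_generated_by {blinfun_apply f -` U | (f :: 'b \<Rightarrow>\<^sub>L real) U. open U}"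

text \<open>
  \<open>P\<close> is the set of pairs \<open>(S, F)\<close>, where \<open>S\<close> lives in the completion and \<open>F\<close> in the
  space itself; the condition \<open>\<iota> x \<in> S\<close> expresses membership of \<open>x\<close> in the trace of \<open>S\<close>
  on the space.
\<close>

definition Gamma2_hat :: "('a::real_normed_vector \<Rightarrow> 'b::banach) \<Rightarrow> ('a \<Rightarrow> 'a) set" where
  "Gamma2_hat \<iota> = {h. \<exists>P :: ('b set \<times> 'a set) set.
      (\<forall>(S, F)\<in>P. subspace F \<and> (\<exists>B. finite B \<and> F = span B)) \<and>
      (\<forall>(S, F)\<in>P. closedin weak_topology S) \<and>
      locally_finite_in euclidean (fst ` P) \<and>
      bounded (\<Union>(fst ` P)) \<and>
      (\<forall>(S, F)\<in>P. \<forall>x. \<iota> x \<in> S \<longrightarrow> h x - x \<in> F) \<and>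
      (\<forall>x. \<iota> x \<notin> \<Union>(fst ` P) \<longrightarrow> h x = x)}"

definition Gamma2 :: "('a::real_normed_vector \<Rightarrow> 'b::banach) \<Rightarrow> ('a \<Rightarrow> 'a) set" where
  "Gamma2 \<iota> = generated_semigroup (Gamma2_hat \<iota>)"

end

theory Submission
  imports Defs
begin

text \<open>
  A null sequence has only finitely many coordinates of modulus at least \<open>1/2\<close>. Hence clamping
  every coordinate of the points of the unit ball to \<open>[-1/2, 1/2]\<close>, which maps the ball into the
  ball of half the radius, changes each point only within a finite dimensional subspace. This
  subspace is determined by the position \<open>j\<close> of the last coordinate of modulus at least \<open>1/2\<close>.
  Allowing equality in both the lower bound at \<open>j\<close> and the upper bound beyond \<open>j\<close> gives weakly
  closed pieces of the ball; they are locally finite because in a small ball of \<open>c0\<close> the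
  coordinates are uniformly small from some index on.
\<close>

text \<open>An isometric image of a complete space is complete, hence closed, and density then makes
  it everything. So a completion of \<open>c0\<close> is \<open>c0\<close> itself up to isometry,
  and its subsets can be described in \<open>c0\<close>.\<close>

lemma is_completion_bij:
  fixes \<iota> :: "'a::banach \<Rightarrow> 'b::banach"
  assumes "is_completion \<iota>"
  shows "bij \<iota>"
proof -
  have lin: "linear \<iota>" and iso: "\<And>x. norm (\<iota> x) = norm x" and dense: "closure (range \<iota>) = UNIV"
    using assms by (auto simp: is_completion_def)
  have "bounded_linear \<iota>"
    using lin iso by (auto simp: bounded_linear_def bounded_linear_axioms_def intro!: exI[of _ 1])
  then have "complete (range \<iota>)"
    by (intro complete_isometric_image[of 1]) (auto simp: iso complete_UNIV)
  then have "surj \<iota>"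
    using dense by (metis closure_closed complete_imp_closed)
  moreover have "inj \<iota>"
    using linear_injective_0[OF lin] by (metis iso norm_eq_zero)
  ultimately show ?thesis by (simp add: bij_def)
qed

lemma topspace_weak_topology [simp]: "topspace weak_topology = UNIV"
  by (auto simp: weak_topology_def intro!: exI[of _ UNIV])

lemma closedin_weak_topology_vimage:
  fixes f :: "'b::real_normed_vector \<Rightarrow>\<^sub>L real"
  assumes "closed C"
  shows "closedin weak_topology (blinfun_apply f -` C)"
proof -
  have "openin weak_topology (blinfun_apply f -` (- C))"
    unfolding weak_topology_def
    by (rule topology_generated_by_Basis) (use assms in blast)
  then show ?thesis by (simp add: closedin_def vimage_Compl flip: Compl_eq_Diff_UNIV)
qed

lift_definition unit_c0 :: "nat \<Rightarrow> c0" is "\<lambda>k n. if n = k then 1 else 0"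
proof -
  fix k :: nat
  have "\<forall>n\<ge>Suc k. (if n = k then 1 else 0) = (0::real)" by simp
  then show "(\<lambda>n. if n = k then 1 else 0) \<longlonglongrightarrow> (0::real)"
    by (intro tendsto_eventually) (unfold eventually_sequentially, blast)
qed

text \<open>The absolute values make the interval contain 0 for every real \<open>a\<close>, so null
  sequences stay null without a sign hypothesis.\<close>

lift_definition clamp_c0 :: "real \<Rightarrow> c0 \<Rightarrow> c0"
  is "\<lambda>a x n. max (- \<bar>a\<bar>) (min \<bar>a\<bar> (x n))"
proof -
  fix a :: real and x :: "nat \<Rightarrow> real"
  assume "x \<longlonglongrightarrow> 0"
  then have "(\<lambda>n. max (- \<bar>a\<bar>) (min \<bar>a\<bar> (x n))) \<longlonglongrightarrow> max (- \<bar>a\<bar>) (min \<bar>a\<bar> 0)"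
    by (intro tendsto_intros)
  then show "(\<lambda>n. max (- \<bar>a\<bar>) (min \<bar>a\<bar> (x n))) \<longlonglongrightarrow> 0" by simp
qed

lemma norm_clamp_c0_le: "norm (clamp_c0 a x) \<le> \<bar>a\<bar>"
  by (rule norm_c0_le) (auto simp: clamp_c0.rep_eq)

lemma clamp_c0_nth_eq: "\<bar>seq_c0 x n\<bar> \<le> \<bar>a\<bar> \<Longrightarrow> seq_c0 (clamp_c0 a x) n = seq_c0 x n"
  by (auto simp: clamp_c0.rep_eq)

lemma clamp_c0_eq: "(\<And>n. \<bar>seq_c0 x n\<bar> \<le> \<bar>a\<bar>) \<Longrightarrow> clamp_c0 a x = x"
  by (rule c0_eqI) (rule clamp_c0_nth_eq)

lemma seq_c0_sum: "seq_c0 (sum f A) n = (\<Sum>i\<in>A. seq_c0 (f i) n)"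
  by (induction A rule: infinite_finite_induct) (auto simp: zero_c0.rep_eq plus_c0.rep_eq)

lemma c0_in_span_units:
  assumes "\<And>n. n > j \<Longrightarrow> seq_c0 x n = 0"
  shows "x \<in> span (unit_c0 ` {..j})"
proof -
  have "x = (\<Sum>i\<le>j. seq_c0 x i *\<^sub>R unit_c0 i)"
    by (rule c0_eqI)
      (use assms in \<open>auto simp: seq_c0_sum scaleR_c0.rep_eq unit_c0.rep_eq if_distrib cong: if_cong\<close>)
  also have "\<dots> \<in> span (unit_c0 ` {..j})"
    by (intro span_sum span_scale span_base) auto
  finally show ?thesis .
qed

lemma bounded_linear_seq_c0: "bounded_linear (\<lambda>x. seq_c0 x n)"
  by (rule bounded_linear_intro[of _ 1])
    (auto simp: plus_c0.rep_eq scaleR_c0.rep_eq abs_seq_c0_le_norm)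

text \<open>The tail of the centre and the distance to \<open>y\<close> each contribute less than
  \<open>e / 2\<close>. One index \<open>N\<close> serves the whole ball, which is what local
  finiteness needs.\<close>

lemma seq_c0_locally_small:
  assumes "e > 0"
  obtains d N where "d > 0" "\<And>y n. dist x y < d \<Longrightarrow> n \<ge> N \<Longrightarrow> \<bar>seq_c0 y n\<bar> < e"
proof -
  obtain N where N: "\<And>n. n \<ge> N \<Longrightarrow> \<bar>seq_c0 x n\<bar> < e / 2"
    using LIMSEQ_D[OF seq_c0_tendsto, of "e / 2" x] assms by auto
  have "\<bar>seq_c0 y n\<bar> < e" if "dist x y < e / 2" "n \<ge> N" for y n
    using N[OF that(2)] abs_seq_c0_le_norm[of "x - y" n] that(1)
    by (simp add: dist_norm minus_c0.rep_eq)
  with that[of "e / 2" N] assms show ?thesis by simp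
qed

text \<open>Ties at 1/2 let a point lie in several of these sets. This is harmless, since the span
  condition holds for each of them separately.\<close>

definition last_large :: "nat \<Rightarrow> c0 set" where
  "last_large j = {x. norm x \<le> 1 \<and> 1/2 \<le> \<bar>seq_c0 x j\<bar> \<and> (\<forall>n>j. \<bar>seq_c0 x n\<bar> \<le> 1/2)}"

text \<open>The greatest index of a large coordinate serves as \<open>j\<close>. Read
  contrapositively, a point of the unit ball outside all pieces has every coordinate of modulus
  below 1/2, so clamping fixes it.\<close>

lemma last_large_exists:
  assumes "norm x \<le> 1" "1/2 \<le> \<bar>seq_c0 x k\<bar>"
  shows "\<exists>j. x \<in> last_large j"
proof -
  obtain N where N: "\<And>n. n \<ge> N \<Longrightarrow> \<bar>seq_c0 x n\<bar> < 1/2"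
    using seq_c0_locally_small[of "1/2" x] by (metis dist_self half_gt_zero zero_less_one)
  let ?K = "{n. 1/2 \<le> \<bar>seq_c0 x n\<bar>}"
  have "?K \<subseteq> {..<N}" using N by (force simp: not_le[symmetric])
  then have fin: "finite ?K" by (rule finite_subset) simp
  have "Max ?K \<in> ?K" using fin assms(2) by (intro Max_in) auto
  moreover have "\<bar>seq_c0 x n\<bar> \<le> 1/2" if "n > Max ?K" for n
    using Max_ge[OF fin, of n] that by fastforce
  ultimately have "x \<in> last_large (Max ?K)" using assms(1) by (auto simp: last_large_def)
  then show ?thesis ..
qed

text \<open>The jump across the unit sphere is allowed, since members of \<open>Gamma2_hat\<close>
  may be discontinuous; being the identity outside the ball permits bounded pieces.\<close>

definition half_ball :: "c0 \<Rightarrow> c0" where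
  "half_ball x = (if norm x \<le> 1 then clamp_c0 (1/2) x else x)"

lemma half_ball_in_Gamma2_hat:
  fixes \<iota> :: "c0 \<Rightarrow> 'b::banach"
  assumes "is_completion \<iota>"
  shows "half_ball \<in> Gamma2_hat \<iota>"
proof -
  have lin: "linear \<iota>" and iso: "\<And>x. norm (\<iota> x) = norm x"
    using assms by (auto simp: is_completion_def)
  have inj: "inj \<iota>" and surj: "surj \<iota>"
    using is_completion_bij[OF assms] by (auto simp: bij_def)
  have dist_\<iota>: "dist (\<iota> x) (\<iota> y) = dist x y" for x y
    by (simp add: dist_norm iso flip: linear_diff[OF lin])
  have bl_inv: "bounded_linear (inv \<iota>)"
  proof (rule bounded_linear_intro[of _ 1])
    fix a b r
    show "inv \<iota> (a + b) = inv \<iota> a + inv \<iota> b"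
      by (rule injD[OF inj]) (simp add: linear_add[OF lin] surj_f_inv_f[OF surj])
    show "inv \<iota> (r *\<^sub>R a) = r *\<^sub>R inv \<iota> a"
      by (rule injD[OF inj]) (simp add: linear_scale[OF lin] surj_f_inv_f[OF surj])
    show "norm (inv \<iota> a) \<le> norm a * 1"
      by (simp add: iso[of "inv \<iota> a", symmetric] surj_f_inv_f[OF surj])
  qed
  \<comment> \<open>The coordinates become bounded functionals on the completion, where weak
    closedness is tested.\<close>
  define f where "f n = Blinfun (\<lambda>b. seq_c0 (inv \<iota> b) n)" for n
  have f: "blinfun_apply (f n) (\<iota> x) = seq_c0 x n" for n x
    unfolding f_def
    by (simp add: bounded_linear_Blinfun_apply inj
        bounded_linear_compose[OF bounded_linear_seq_c0 bl_inv])
  define P where "P = range (\<lambda>j. (\<iota> ` last_large j, span (unit_c0 ` {..j})))"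
  have fst_P: "fst ` P = range (\<lambda>j. \<iota> ` last_large j)"
    by (simp add: P_def image_image)
  have mem: "\<iota> x \<in> \<iota> ` A \<longleftrightarrow> x \<in> A" for x A
    by (rule inj_image_mem_iff[OF inj])
  have closed: "closedin weak_topology (\<iota> ` last_large j)" for j
  proof -
    \<comment> \<open>Every condition on a piece, the norm bound included, constrains one coordinate
      at a time, so the piece is an intersection of preimages of closed sets of reals.\<close>
    define C where "C n = {c::real. \<bar>c\<bar> \<le> 1 \<and> (n = j \<longrightarrow> 1/2 \<le> \<bar>c\<bar>) \<and> (n > j \<longrightarrow> \<bar>c\<bar> \<le> 1/2)}" for n
    have C: "closed (C n)" for n
      unfolding C_def by (intro closed_Collect_conj closed_Collect_imp closed_Collect_le
          continuous_intros) auto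
    have norm1: "norm x \<le> 1 \<longleftrightarrow> (\<forall>n. \<bar>seq_c0 x n\<bar> \<le> 1)" for x
      using norm_c0_le abs_seq_c0_le_norm order_trans by meson
    have "\<iota> ` last_large j = (\<Inter>n. blinfun_apply (f n) -` C n)"
    proof (rule set_eqI)
      fix b
      obtain x where b: "b = \<iota> x" using surj by (rule surjE)
      show "b \<in> \<iota> ` last_large j \<longleftrightarrow> b \<in> (\<Inter>n. blinfun_apply (f n) -` C n)"
        unfolding b mem by (auto simp: f C_def last_large_def norm1)
    qed
    moreover have "closedin weak_topology (\<Inter>n. blinfun_apply (f n) -` C n)"
      by (intro closedin_INT closedin_weak_topology_vimage C) simp
    ultimately show ?thesis by simp
  qed
  have "locally_finite_in euclidean (fst ` P)"
    unfolding locally_finite_in_def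
  proof (intro conjI ballI)
    fix b :: 'b
    obtain x where b: "b = \<iota> x" using surj by (rule surjE)
    obtain d N where d: "d > 0" and small: "\<And>y n. dist x y < d \<Longrightarrow> n \<ge> N \<Longrightarrow> \<bar>seq_c0 y n\<bar> < 1/2"
      using seq_c0_locally_small[of "1/2" x] by auto
    \<comment> \<open>A common point has a coordinate of modulus at least 1/2 at \<open>j\<close>,
      impossible in this ball from index \<open>N\<close> on.\<close>
    have "j < N" if meets: "\<iota> ` last_large j \<inter> ball b d \<noteq> {}" for j
    proof -
      obtain y where "y \<in> last_large j" "\<iota> y \<in> ball b d"
        using meets by blast
      then have "y \<in> last_large j" "dist x y < d"
        by (simp_all add: b dist_\<iota>)
      then show ?thesis using small[of y j] by (auto simp: last_large_def not_le[symmetric])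
    qed
    then have "{U \<in> fst ` P. U \<inter> ball b d \<noteq> {}} \<subseteq> (\<lambda>j. \<iota> ` last_large j) ` {..<N}"
      unfolding fst_P by blast
    then have "finite {U \<in> fst ` P. U \<inter> ball b d \<noteq> {}}"
      by (rule finite_subset) simp
    then show "\<exists>V. openin euclidean V \<and> b \<in> V \<and> finite {U \<in> fst ` P. U \<inter> V \<noteq> {}}"
      using d by (intro exI[of _ "ball b d"]) auto
  qed simp
  moreover have "bounded (\<Union>(fst ` P))"
    unfolding fst_P by (rule boundedI[of _ 1]) (auto simp: last_large_def iso)
  \<comment> \<open>Clamping changes no coordinate beyond \<open>j\<close>, so the difference
    vanishes there.\<close>
  moreover have "half_ball x - x \<in> span (unit_c0 ` {..j})" if "x \<in> last_large j" for x j
    by (rule c0_in_span_units)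
      (use that in \<open>auto simp: half_ball_def last_large_def minus_c0.rep_eq clamp_c0_nth_eq\<close>)
  then have "\<forall>(S, F)\<in>P. \<forall>x. \<iota> x \<in> S \<longrightarrow> half_ball x - x \<in> F"
    by (auto simp: P_def mem)
  moreover have "half_ball x = x" if "\<iota> x \<notin> \<Union>(fst ` P)" for x
  proof (cases "norm x \<le> 1")
    case True
    have "x \<notin> last_large j" for j
      using that unfolding fst_P by auto
    then have "\<bar>seq_c0 x n\<bar> \<le> 1/2" for n
      using last_large_exists[OF True, of n] by force
    then show ?thesis by (simp add: half_ball_def clamp_c0_eq)
  qed (simp add: half_ball_def)
  moreover have "\<forall>(S, F)\<in>P. closedin weak_topology S"
    by (auto simp: P_def closed)
  moreover have "\<exists>B. finite B \<and> span (unit_c0 ` {..j}) = span B" for j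
    by (rule exI[of _ "unit_c0 ` {..j}"]) simp
  then have "\<forall>(S, F)\<in>P. subspace F \<and> (\<exists>B. finite B \<and> F = span B)"
    by (auto simp: P_def)
  ultimately show ?thesis
    unfolding Gamma2_hat_def by (intro CollectI exI[of _ P] conjI allI impI)
qed

theorem proposition3p11:
  fixes \<iota> :: "c0 \<Rightarrow> 'b::banach"
  assumes "is_completion \<iota>"
  shows "\<not> non_shrinking (Gamma2 \<iota>)"
proof -
  have "half_ball \<in> Gamma2 \<iota>"
    unfolding Gamma2_def by (intro generated_semigroup.base half_ball_in_Gamma2_hat assms)
  \<comment> \<open>A single ball already violates the property: its radius 1/2 is less than
    1.\<close>
  moreover have "half_ball ` cball 0 1 \<subseteq> (\<Union>(c, s)\<in>{(0, 1/2)}. cball c s)"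
    using norm_clamp_c0_le[of "1/2"] by (auto simp: half_ball_def)
  ultimately show ?thesis
    unfolding non_shrinking_def not_not
    by (intro bexI[of _ half_ball] exI[of _ 0] exI[of _ 1] conjI exI[of _ "{(0, 1/2)}"]) auto
qed

end
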